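(* Let $\mathbf X=(X,\mathcal E)$, $\mathbf Y=(Y,\mathcal F)$ be coarse spaces, $\mathcal H_{\mathbf X}$ an $\mathbf X$-module and $\mathcal H_{\mathbf Y}$ a $\mathbf Y$-module. Let $\widetilde E_{\mathbf X}$ and $\widetilde F_{\mathbf Y}$ be non-degeneracy gauges for $\mathcal H_{\mathbf X}$ and $\mathcal H_{\mathbf Y}$ respectively, and let $t\colon\mathcal H_{\mathbf X}\to\mathcal H_{\mathbf Y}$ be a bounded operator. Let $$S=\bigcup\{B\times A:\ A\subseteq X \text{ measurable and }\widetilde E_{\mathbf X}\text{-bounded},\ B\subseteq Y\text{ measurable and }\widetilde F_{\mathbf Y}\text{-bounded},\ \mathbb 1_Bt\mathbb 1_A\neq0\}\subseteq Y\times X.$$ Then $[S]$ is the coarse support of $t$.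
   Context: Relations. A relation from $X$ to $Y$ is a subset $R\subseteq Y\times X$; $R^{T}=\{(x,y):(y,x)\in R\}$; $R_2\circ R_1=\{(z,x):\exists y,\ (z,y)\in R_2,\ (y,x)\in R_1\}$; $R(A)=\{y:\exists a\in A,\ (y,a)\in R\}$. $B\subseteq Y$ and $A\subseteq X$ are $R$-separated if $B\cap R(A)=\emptyset$. A coarse structure on $X$ is a non-empty family $\mathcal E$ of subsets of $X\times X$, closed under subsets and finite unions, containing the diagonal $\Delta_X$, and closed under $E\mapsto E^T$ and under composition; $\mathbf X=(X,\mathcal E)$ is a coarse space. A gauge is a symmetric element of $\mathcal E$ containing $\Delta_X$. $A\subseteq X$ is $E$-bounded if $A\times A\subseteq E$. For relations $R,R'\subseteq Y\times X$ write $R'\preccurlyeq R$ if $R'\subseteq F\circ R\circ E$ for some $F\in\mathcal F$, $E\in\mathcal E$, and $R\asymp R'$ if $R\preccurlyeq R'\preccurlyeq R$. A coarse subspace of $\mathbf Y\times\mathbf X$ is an $\asymp$-class $[R]$ of relations. An $\mathbf X$-module consists of a Boolean algebra $\mathfrak A$ of subsets of $X$ with $X\in\mathfrak A$ (its members are called measurable), a Hilbert space $\mathcal H$, and a map $\mathbb 1_\bullet$ from $\mathfrak A$ to projections (self-adjoint idempotents) in $\mathcal B(\mathcal H)$ with $\mathbb 1_\emptyset=0$, $\mathbb 1_X=1$, $\mathbb 1_{A\cap B}=\mathbb 1_A\mathbb 1_B$, $\mathbb 1_{A\cup B}=\mathbb 1_A+\mathbb 1_B-\mathbb 1_A\mathbb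 1_B$, which is non-degenerate: there is a gauge $\widetilde E$ (called a non-degeneracy gauge) such that the subspaces $\mathbb 1_A(\mathcal H)$ with $A$ measurable and $\widetilde E$-bounded span a dense subspace of $\mathcal H$. For $R\subseteq Y\times X$ write $\mathrm{Supp}(t)\subseteq R$ if $\mathbb 1_Bt\mathbb 1_A=0$ for all $R$-separated measurable $B\subseteq Y$, $A\subseteq X$. A coarse subspace $[S]$ of $\mathbf Y\times\mathbf X$ is the coarse support of $t$ if $\mathrm{Supp}(t)\subseteq S$ and $S\preccurlyeq R$ for every $R\subseteq Y\times X$ with $\mathrm{Supp}(t)\subseteq R$. *)

theory Defs
  imports "HOL-Analysis.Analysis"
begin

class complex_vector = real_vector +
  fixes scaleC :: "complex \<Rightarrow> 'a \<Rightarrow> 'a"  (infixr \<open>*\<^sub>C\<close> 75)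
  assumes scaleC_add_right: "a *\<^sub>C (x + y) = a *\<^sub>C x + a *\<^sub>C y"
    and scaleC_add_left: "(a + b) *\<^sub>C x = a *\<^sub>C x + b *\<^sub>C x"
    and scaleC_scaleC: "a *\<^sub>C b *\<^sub>C x = (a * b) *\<^sub>C x"
    and scaleC_one: "1 *\<^sub>C x = x"
    and scaleC_of_real: "complex_of_real r *\<^sub>C x = r *\<^sub>R x"

text \<open>
  The inner product is conjugate-linear in the first argument.  The norm comes from
  the class \<open>real_inner\<close>: it is \<open>sqrt (inner x x)\<close>, hence the norm of \<open>cinner\<close> by
  \<open>inner_eq_Re_cinner\<close>.
\<close>

class complex_inner = complex_vector + real_inner +
  fixes cinner :: "'a \<Rightarrow> 'a \<Rightarrow> complex"
  assumes cinner_commute: "cinner x y = cnj (cinner y x)"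
    and cinner_add_right: "cinner x (y + z) = cinner x y + cinner x z"
    and cinner_scaleC_right: "cinner x (c *\<^sub>C y) = c * cinner x y"
    and inner_eq_Re_cinner: "inner x y = Re (cinner x y)"

class chilbert_space = complex_inner + complete_space

global_interpretation complex_vector: vector_space "scaleC :: complex \<Rightarrow> 'a::complex_vector \<Rightarrow> 'a"
  defines cspan = complex_vector.span
  by unfold_locales
    (simp_all add: scaleC_add_right scaleC_add_left scaleC_scaleC scaleC_one)

instantiation complex :: chilbert_space
begin

definition scaleC_complex :: "complex \<Rightarrow> complex \<Rightarrow> complex"
  where "scaleC_complex c x = c * x"

definition cinner_complex :: "complex \<Rightarrow> complex \<Rightarrow> complex"
  where "cinner_complex x y = cnj x * y"

instance
  by standard
    (simp_all add: scaleC_complex_def cinner_complex_def inner_complex_def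
      algebra_simps scaleR_conv_of_real)

end

definition bounded_clinear :: "('a::complex_inner \<Rightarrow> 'b::complex_inner) \<Rightarrow> bool"
  where "bounded_clinear t \<longleftrightarrow> bounded_linear t \<and> (\<forall>c x. t (c *\<^sub>C x) = c *\<^sub>C t x)"

definition projection :: "('a::complex_inner \<Rightarrow> 'a) \<Rightarrow> bool"
  where "projection p \<longleftrightarrow>
    bounded_clinear p \<and> (\<forall>x y. cinner (p x) y = cinner x (p y)) \<and> p \<circ> p = p"

text \<open>
  A relation from \<open>X\<close> to \<open>Y\<close> is a subset of \<open>Y \<times> X\<close> (target first), so that the composite
  of \<open>R\<^sub>1\<close> followed by \<open>R\<^sub>2\<close> is \<open>R\<^sub>2 O R\<^sub>1\<close>, while the image of \<open>A\<close> under \<open>R\<close> is \<open>R\<inverse> `` A\<close>.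
\<close>

locale coarse_space =
  fixes X :: "'x set" and \<E> :: "('x \<times> 'x) set set"
  assumes subsets: "\<E> \<subseteq> Pow (X \<times> X)"
    and nonempty: "\<E> \<noteq> {}"
    and subset_closed: "E \<in> \<E> \<Longrightarrow> E' \<subseteq> E \<Longrightarrow> E' \<in> \<E>"
    and Un_closed: "E \<in> \<E> \<Longrightarrow> E' \<in> \<E> \<Longrightarrow> E \<union> E' \<in> \<E>"
    and diagonal: "Id_on X \<in> \<E>"
    and converse_closed: "E \<in> \<E> \<Longrightarrow> E\<inverse> \<in> \<E>"
    and comp_closed: "E \<in> \<E> \<Longrightarrow> E' \<in> \<E> \<Longrightarrow> E O E' \<in> \<E>"

definition gauge_of :: "'x set \<Rightarrow> ('x \<times> 'x) set set \<Rightarrow> ('x \<times> 'x) set \<Rightarrow> bool"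
  where "gauge_of X \<E> E \<longleftrightarrow> E \<in> \<E> \<and> sym E \<and> Id_on X \<subseteq> E"

definition rel_bounded :: "('x \<times> 'x) set \<Rightarrow> 'x set \<Rightarrow> bool"
  where "rel_bounded E A \<longleftrightarrow> A \<times> A \<subseteq> E"

definition rel_separated :: "('y \<times> 'x) set \<Rightarrow> 'y set \<Rightarrow> 'x set \<Rightarrow> bool"
  where "rel_separated R B A \<longleftrightarrow> B \<inter> R\<inverse> `` A = {}"

definition coarse_le ::
  "('x \<times> 'x) set set \<Rightarrow> ('y \<times> 'y) set set \<Rightarrow> ('y \<times> 'x) set \<Rightarrow> ('y \<times> 'x) set \<Rightarrow> bool"
  where "coarse_le \<E> \<F> R' R \<longleftrightarrow> (\<exists>F\<in>\<F>. \<exists>E\<in>\<E>. R' \<subseteq> F O R O E)"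

definition coarse_asymp ::
  "('x \<times> 'x) set set \<Rightarrow> ('y \<times> 'y) set set \<Rightarrow> ('y \<times> 'x) set \<Rightarrow> ('y \<times> 'x) set \<Rightarrow> bool"
  where "coarse_asymp \<E> \<F> R R' \<longleftrightarrow> coarse_le \<E> \<F> R' R \<and> coarse_le \<E> \<F> R R'"

definition coarse_class ::
  "'x set \<Rightarrow> ('x \<times> 'x) set set \<Rightarrow> 'y set \<Rightarrow> ('y \<times> 'y) set set \<Rightarrow>
    ('y \<times> 'x) set \<Rightarrow> ('y \<times> 'x) set set"
  where "coarse_class X \<E> Y \<F> R = {R'. R' \<subseteq> Y \<times> X \<and> coarse_asymp \<E> \<F> R R'}"

definition nondegeneracy_gauge ::
  "'x set \<Rightarrow> ('x \<times> 'x) set set \<Rightarrow> 'x set set \<Rightarrow> ('x set \<Rightarrow> 'h \<Rightarrow> 'h::chilbert_space) \<Rightarrow>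
    ('x \<times> 'x) set \<Rightarrow> bool"
  where "nondegeneracy_gauge X \<E> \<AA> \<pi> E \<longleftrightarrow>
    gauge_of X \<E> E \<and>
    closure (cspan (\<Union>A\<in>{A\<in>\<AA>. rel_bounded E A}. range (\<pi> A))) = UNIV"

text \<open>
  \<open>\<pi> A\<close> is the projection associated with the measurable set \<open>A \<in> \<AA>\<close>; its values on
  non-measurable sets are irrelevant.
\<close>

locale coarse_module = coarse_space X \<E> + algebra X \<AA>
  for X :: "'x set" and \<E> :: "('x \<times> 'x) set set" and \<AA> :: "'x set set" +
  fixes \<pi> :: "'x set \<Rightarrow> 'h \<Rightarrow> 'h::chilbert_space"
  assumes projection: "A \<in> \<AA> \<Longrightarrow> projection (\<pi> A)"
    and proj_empty: "\<pi> {} = (\<lambda>_. 0)"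
    and proj_space: "\<pi> X = id"
    and proj_Int: "A \<in> \<AA> \<Longrightarrow> B \<in> \<AA> \<Longrightarrow> \<pi> (A \<inter> B) = \<pi> A \<circ> \<pi> B"
    and proj_Un: "A \<in> \<AA> \<Longrightarrow> B \<in> \<AA> \<Longrightarrow> \<pi> (A \<union> B) = (\<lambda>v. \<pi> A v + \<pi> B v - \<pi> A (\<pi> B v))"
    and nondegenerate: "\<exists>E. nondegeneracy_gauge X \<E> \<AA> \<pi> E"

definition supp_subset ::
  "'x set set \<Rightarrow> ('x set \<Rightarrow> 'h \<Rightarrow> 'h::chilbert_space) \<Rightarrow>
    'y set set \<Rightarrow> ('y set \<Rightarrow> 'k \<Rightarrow> 'k::chilbert_space) \<Rightarrow>
    ('h \<Rightarrow> 'k) \<Rightarrow> ('y \<times> 'x) set \<Rightarrow> bool"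
  where "supp_subset \<AA> \<pi> \<BB> \<rho> t R \<longleftrightarrow>
    (\<forall>B\<in>\<BB>. \<forall>A\<in>\<AA>. rel_separated R B A \<longrightarrow> \<rho> B \<circ> t \<circ> \<pi> A = (\<lambda>_. 0))"

text \<open>
  Containment of the support depends on the representative of a coarse subspace, not only
  on its class: \<open>C\<close> is the coarse support if the defining conditions hold for some
  representative \<open>S\<close> of \<open>C\<close>.
\<close>

definition is_coarse_support ::
  "'x set \<Rightarrow> ('x \<times> 'x) set set \<Rightarrow> 'x set set \<Rightarrow> ('x set \<Rightarrow> 'h \<Rightarrow> 'h::chilbert_space) \<Rightarrow>
    'y set \<Rightarrow> ('y \<times> 'y) set set \<Rightarrow> 'y set set \<Rightarrow> ('y set \<Rightarrow> 'k \<Rightarrow> 'k::chilbert_space) \<Rightarrow>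
    ('h \<Rightarrow> 'k) \<Rightarrow> ('y \<times> 'x) set set \<Rightarrow> bool"
  where "is_coarse_support X \<E> \<AA> \<pi> Y \<F> \<BB> \<rho> t C \<longleftrightarrow>
    (\<exists>S. S \<subseteq> Y \<times> X \<and> C = coarse_class X \<E> Y \<F> S \<and>
      supp_subset \<AA> \<pi> \<BB> \<rho> t S \<and>
      (\<forall>R. R \<subseteq> Y \<times> X \<and> supp_subset \<AA> \<pi> \<BB> \<rho> t R \<longrightarrow> coarse_le \<E> \<F> S R))"

end

theory Submission
  imports Defs
begin

text \<open>
  If \<open>B\<close> and \<open>A\<close> are \<open>S\<close>-separated, then so are \<open>B \<inter> B'\<close> and \<open>A \<inter> A'\<close> for all bounded measurable
  \<open>A'\<close> and \<open>B'\<close>, whence \<open>\<rho> B' \<circ> \<rho> B \<circ> t \<circ> \<pi> A \<circ> \<pi> A' = 0\<close>.  The ranges of the \<open>\<pi> A'\<close> and of the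
  \<open>\<rho> B'\<close> span dense subspaces, and so \<open>\<rho> B \<circ> t \<circ> \<pi> A = 0\<close>.  Conversely, if \<open>\<rho> B \<circ> t \<circ> \<pi> A \<noteq> 0\<close> with
  \<open>A\<close> and \<open>B\<close> bounded, then \<open>B \<times> A\<close> meets every \<open>R\<close> containing the support, and a point of
  \<open>R \<inter> B \<times> A\<close> is within the two gauges of every other point of \<open>B \<times> A\<close>.
\<close>

lemma cinner_zero_right [simp]: "cinner x 0 = 0"
  using cinner_add_right[of x 0 0] by simp

lemma cinner_zero_left [simp]: "cinner 0 x = 0"
  using cinner_commute[of 0 x] by simp

lemma bounded_clinear_zero:
  assumes "bounded_clinear f"
  shows "f 0 = 0"
  using assms unfolding bounded_clinear_def by (blast intro: linear_simps)

lemma bounded_clinear_compose: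
  assumes "bounded_clinear f" "bounded_clinear g"
  shows "bounded_clinear (f \<circ> g)"
  using assms unfolding bounded_clinear_def
  by (auto simp: comp_def intro: bounded_linear_compose)

text \<open>The kernel of \<open>f\<close> is a closed complex subspace, so it contains the closed
  span of \<open>G\<close>.\<close>

lemma bounded_clinear_eq_zero_on_dense:
  assumes f: "bounded_clinear f"
    and dense: "closure (cspan G) = UNIV"
    and zero: "\<And>v. v \<in> G \<Longrightarrow> f v = 0"
  shows "f = (\<lambda>_. 0)"
proof
  fix v
  have lin: "bounded_linear f" and scale: "\<And>c x. f (c *\<^sub>C x) = c *\<^sub>C f x"
    using f by (auto simp: bounded_clinear_def)
  have "complex_vector.subspace {v. f v = 0}"
    unfolding complex_vector.subspace_def
    by (simp add: scale linear_simps[OF lin] bounded_clinear_zero[OF f])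
  then have "cspan G \<subseteq> {v. f v = 0}"
    by (intro complex_vector.span_minimal) (auto simp: zero)
  moreover have "closed {v. f v = 0}"
    using lin by (intro closed_Collect_eq)
      (auto intro: bounded_linear.continuous_on continuous_on_id)
  ultimately have "closure (cspan G) \<subseteq> {v. f v = 0}"
    by (rule closure_minimal)
  then show "f v = 0"
    using dense by auto
qed

text \<open>By density \<open>w\<close> is orthogonal to every vector, in particular to
  itself.\<close>

lemma eq_zero_if_orthogonal_to_dense:
  fixes w :: "'a::complex_inner"
  assumes dense: "closure (cspan G) = UNIV"
    and orth: "\<And>v. v \<in> G \<Longrightarrow> cinner w v = 0"
  shows "w = 0"
proof -
  have "complex_vector.subspace {v. cinner w v = 0}"
    unfolding complex_vector.subspace_def
    by (simp add: cinner_add_right cinner_scaleC_right)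
  then have "cspan G \<subseteq> {v. cinner w v = 0}"
    by (intro complex_vector.span_minimal) (auto simp: orth)
  \<comment> \<open>The real part suffices from here on: \<open>inner\<close> is continuous, so its
    zero set is closed, and \<open>inner w w = 0\<close> forces \<open>w = 0\<close>.\<close>
  then have "cspan G \<subseteq> {v. inner w v = 0}"
    by (auto simp: inner_eq_Re_cinner)
  then have "closure (cspan G) \<subseteq> {v. inner w v = 0}"
    by (intro closure_minimal) (auto intro!: closed_Collect_eq continuous_intros)
  then have "w \<in> {v. inner w v = 0}"
    unfolding dense by (rule subsetD) simp
  then show ?thesis
    by simp
qed

context coarse_module
begin

lemma proj_commute:
  assumes "A \<in> \<AA>" "B \<in> \<AA>"
  shows "\<pi> A \<circ> \<pi> B = \<pi> B \<circ> \<pi> A"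
  using assms by (metis Int_commute proj_Int)

text \<open>Serves the domain side, where bounded cut-offs are precomposed.\<close>

lemma vanishes_if_vanishes_on_bounded_ranges:
  assumes "nondegeneracy_gauge X \<E> \<AA> \<pi> E" "bounded_clinear f"
    and "\<And>A. A \<in> \<AA> \<Longrightarrow> rel_bounded E A \<Longrightarrow> f \<circ> \<pi> A = (\<lambda>_. 0)"
  shows "f = (\<lambda>_. 0)"
proof (rule bounded_clinear_eq_zero_on_dense)
  show "closure (cspan (\<Union>A\<in>{A\<in>\<AA>. rel_bounded E A}. range (\<pi> A))) = UNIV"
    using assms(1) by (simp add: nondegeneracy_gauge_def)
qed (use assms(2,3) in \<open>auto simp: fun_eq_iff\<close>)

text \<open>Serves the codomain side: self-adjointness turns \<open>\<pi> A w = 0\<close> into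
  orthogonality of \<open>w\<close> to the range of \<open>\<pi> A\<close>.\<close>

lemma eq_zero_if_bounded_projections_vanish:
  assumes "nondegeneracy_gauge X \<E> \<AA> \<pi> E"
    and "\<And>A. A \<in> \<AA> \<Longrightarrow> rel_bounded E A \<Longrightarrow> \<pi> A w = 0"
  shows "w = 0"
proof (rule eq_zero_if_orthogonal_to_dense)
  show "closure (cspan (\<Union>A\<in>{A\<in>\<AA>. rel_bounded E A}. range (\<pi> A))) = UNIV"
    using assms(1) by (simp add: nondegeneracy_gauge_def)
  fix v
  assume "v \<in> (\<Union>A\<in>{A\<in>\<AA>. rel_bounded E A}. range (\<pi> A))"
  then obtain A u where A: "A \<in> \<AA>" "rel_bounded E A" and v: "v = \<pi> A u"
    by auto
  have "cinner w (\<pi> A u) = cinner (\<pi> A w) u"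
    using projection[OF A(1)] by (simp add: projection_def)
  then show "cinner w v = 0"
    by (simp add: v assms(2)[OF A])
qed

end

lemma rel_bounded_Int: "rel_bounded E A' \<Longrightarrow> rel_bounded E (A \<inter> A')"
  by (auto simp: rel_bounded_def)

theorem proposition5p7:
  fixes X :: "'x set" and \<E> :: "('x \<times> 'x) set set"
    and \<AA> :: "'x set set" and \<pi> :: "'x set \<Rightarrow> 'h \<Rightarrow> 'h::chilbert_space"
    and Y :: "'y set" and \<F> :: "('y \<times> 'y) set set"
    and \<BB> :: "'y set set" and \<rho> :: "'y set \<Rightarrow> 'k \<Rightarrow> 'k::chilbert_space"
    and E\<^sub>X :: "('x \<times> 'x) set" and F\<^sub>Y :: "('y \<times> 'y) set"
    and t :: "'h \<Rightarrow> 'k" and S :: "('y \<times> 'x) set"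
  assumes "coarse_space X \<E>" and "coarse_space Y \<F>"
    and "coarse_module X \<E> \<AA> \<pi>" and "coarse_module Y \<F> \<BB> \<rho>"
    and "nondegeneracy_gauge X \<E> \<AA> \<pi> E\<^sub>X" and "nondegeneracy_gauge Y \<F> \<BB> \<rho> F\<^sub>Y"
    and "bounded_clinear t"
    and S: "S = \<Union>{B \<times> A | A B. A \<in> \<AA> \<and> rel_bounded E\<^sub>X A \<and> B \<in> \<BB> \<and> rel_bounded F\<^sub>Y B \<and>
                          \<rho> B \<circ> t \<circ> \<pi> A \<noteq> (\<lambda>_. 0)}"
  shows "supp_subset \<AA> \<pi> \<BB> \<rho> t S \<and>
         is_coarse_support X \<E> \<AA> \<pi> Y \<F> \<BB> \<rho> t (coarse_class X \<E> Y \<F> S)"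
proof -
  interpret MX: coarse_module X \<E> \<AA> \<pi> by fact
  interpret MY: coarse_module Y \<F> \<BB> \<rho> by fact
  have t0: "t 0 = 0"
    using assms(7) by (rule bounded_clinear_zero)
  have \<rho>0: "\<rho> B 0 = 0" if "B \<in> \<BB>" for B
    using MY.projection[OF that] by (auto simp: projection_def bounded_clinear_zero)
  \<comment> \<open>Consequently a nonzero block has both sets nonempty, so its rectangle contains a
    point.\<close>
  have \<rho>t0: "\<rho> B \<circ> t \<circ> \<pi> A = (\<lambda>_. 0)" if "A = {} \<or> B = {}" "B \<in> \<BB>" for A B
    using that t0 \<rho>0 by (auto simp: fun_eq_iff MX.proj_empty MY.proj_empty)
  have supp: "supp_subset \<AA> \<pi> \<BB> \<rho> t S"
    unfolding supp_subset_def
  proof (intro ballI impI)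
    fix B A
    assume B: "B \<in> \<BB>" and A: "A \<in> \<AA>" and sep: "rel_separated S B A"
    \<comment> \<open>Subsets of bounded sets are bounded, so a nonzero cut block would be one of
      the rectangles forming \<open>S\<close>; a point of it would contradict the separation of
      \<open>B\<close> and \<open>A\<close>.\<close>
    have cut: "\<rho> (B \<inter> B') \<circ> t \<circ> \<pi> (A \<inter> A') = (\<lambda>_. 0)"
      if A': "A' \<in> \<AA>" "rel_bounded E\<^sub>X A'" and B': "B' \<in> \<BB>" "rel_bounded F\<^sub>Y B'" for A' B'
    proof (rule ccontr)
      assume nz: "\<rho> (B \<inter> B') \<circ> t \<circ> \<pi> (A \<inter> A') \<noteq> (\<lambda>_. 0)"
      have meas: "A \<inter> A' \<in> \<AA>" "B \<inter> B' \<in> \<BB>"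
        using A A' B B' by auto
      with nz A' B' have "(B \<inter> B') \<times> (A \<inter> A') \<subseteq> S"
        unfolding S using rel_bounded_Int[of E\<^sub>X A' A] rel_bounded_Int[of F\<^sub>Y B' B] by blast
      moreover obtain a b where "a \<in> A \<inter> A'" "b \<in> B \<inter> B'"
        using nz \<rho>t0 meas by blast
      ultimately show False
        using sep by (auto simp: rel_separated_def)
    qed
    have "bounded_clinear (\<rho> B \<circ> t \<circ> \<pi> A)"
      using MX.projection[OF A] MY.projection[OF B] assms(7)
      by (auto simp: projection_def intro!: bounded_clinear_compose)
    then show "\<rho> B \<circ> t \<circ> \<pi> A = (\<lambda>_. 0)"
    proof (rule MX.vanishes_if_vanishes_on_bounded_ranges[OF assms(5)])
      fix A'
      assume A': "A' \<in> \<AA>" "rel_bounded E\<^sub>X A'"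
      show "\<rho> B \<circ> t \<circ> \<pi> A \<circ> \<pi> A' = (\<lambda>_. 0)"
      proof
        fix v
        show "(\<rho> B \<circ> t \<circ> \<pi> A \<circ> \<pi> A') v = 0"
        proof (rule MY.eq_zero_if_bounded_projections_vanish[OF assms(6)])
          fix B'
          assume B': "B' \<in> \<BB>" "rel_bounded F\<^sub>Y B'"
          \<comment> \<open>\<open>proj_Int\<close> yields
            \<open>\<rho> B \<circ> \<rho> B'\<close>; commuting the factors puts
            \<open>\<rho> B'\<close> outermost.\<close>
          from cut[OF A' B'] show "\<rho> B' ((\<rho> B \<circ> t \<circ> \<pi> A \<circ> \<pi> A') v) = 0"
            using MX.proj_Int[OF A A'(1)] MY.proj_Int[OF B B'(1)] MY.proj_commute[OF B B'(1)]
            by (simp add: fun_eq_iff)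
        qed
      qed
    qed
  qed
  have sub: "S \<subseteq> Y \<times> X"
    unfolding S using MX.space_closed MY.space_closed by blast
  have least: "coarse_le \<E> \<F> S R" if R: "supp_subset \<AA> \<pi> \<BB> \<rho> t R" for R
    unfolding coarse_le_def
  proof (intro bexI)
    show "S \<subseteq> F\<^sub>Y O R O E\<^sub>X"
    proof clarify
      fix y x
      assume "(y, x) \<in> S"
      then obtain A B where A: "A \<in> \<AA>" "rel_bounded E\<^sub>X A" "x \<in> A"
        and B: "B \<in> \<BB>" "rel_bounded F\<^sub>Y B" "y \<in> B"
        and nz: "\<rho> B \<circ> t \<circ> \<pi> A \<noteq> (\<lambda>_. 0)"
        unfolding S by blast
      then have "\<not> rel_separated R B A"
        using R by (auto simp: supp_subset_def)
      then obtain b a where "b \<in> B" "a \<in> A" "(b, a) \<in> R"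
        by (auto simp: rel_separated_def)
      \<comment> \<open>The path is \<open>y\<close>, \<open>b\<close>, \<open>a\<close>,
        \<open>x\<close>: boundedness of \<open>B\<close> gives
        \<open>(y, b) \<in> F\<^sub>Y\<close>, that of \<open>A\<close> gives
        \<open>(a, x) \<in> E\<^sub>X\<close>.\<close>
      then show "(y, x) \<in> F\<^sub>Y O R O E\<^sub>X"
        using A B by (auto simp: rel_bounded_def)
    qed
  qed (use assms(5,6) in \<open>auto simp: nondegeneracy_gauge_def gauge_of_def\<close>)
  \<comment> \<open>The representative chosen for the class is \<open>S\<close> itself.\<close>
  from supp sub least show ?thesis
    unfolding is_coarse_support_def by blast
qed

end
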